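(* Let $R$ be a commutative semiring, $M$ an $R$-semimodule and $N$ a subsemimodule of $M$. Let $S$ be a multiplicatively closed subset of $R$ and $I$ an ideal of $R$ such that $I\cap S=\emptyset$, and assume $IM\subseteq N$ (so that $I(+)N$ is an ideal of $R(+)M$). (i) If $I(+)N$ is a quasi $S(+)M$-$n$-ideal of $R(+)M$, then $I$ is a quasi $S$-$n$-ideal of $R$. (ii) Suppose that $N(R)M\subseteq N$. If $I$ is a quasi $S$-$n$-ideal of $R$, then $I(+)N$ is a quasi $S(+)M$-$n$-ideal of $R(+)M$.
   Context: All semirings are commutative with identity $1\neq 0$. A subset $S$ of a semiring is multiplicatively closed if $0\notin S$, $1\in S$, and $st\in S$ for all $s,t\in S$. $N(R)$ denotes the nilradical (set of nilpotent elements) of $R$ (not to be confused with the subsemimodule $N$). A proper ideal $I$ of $R$ with $I\cap S=\emptyset$ is a quasi $S$-$n$-ideal of $R$ if there exists a fixed element $s\in S$ such that, for all $a,b\in R$, $ab\in I$ implies $sa^2\in I$ or $sb\in N(R)$. The idealization $R(+)M$ is the semiring with underlying set $R\times M$, componentwise addition, and multiplication $(r_1,m_1)(r_2,m_2)=(r_1r_2,\,r_1m_2+r_2m_1)$. For an ideal $I$ of $R$ and a subsemimodule $N$ of $M$, $I(+)N=\{(i,n): i\in I, n\in N\}$, which is an ideal of $R(+)M$ when $IM\subseteq N$. For a multiplicatively closed $S\subseteq R$, $S(+)M=\{(s,m): s\in S, m\in M\}$ is a multiplicatively closed subset of $R(+)M$. *)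

theory Defs
  imports "HOL-Algebra.Module"
begin

locale csemiring = semiring R + comm_monoid R for R (structure) +
  assumes one_not_zero: "\<one> \<noteq> \<zero>"

locale semimodule = R?: csemiring R + M?: abelian_monoid M for R (structure) and M (structure) +
  assumes smult_closed [simp, intro]:
      "\<lbrakk>a \<in> carrier R; x \<in> carrier M\<rbrakk> \<Longrightarrow> a \<odot>\<^bsub>M\<^esub> x \<in> carrier M"
    and smult_l_distr:
      "\<lbrakk>a \<in> carrier R; b \<in> carrier R; x \<in> carrier M\<rbrakk> \<Longrightarrow>
        (a \<oplus> b) \<odot>\<^bsub>M\<^esub> x = a \<odot>\<^bsub>M\<^esub> x \<oplus>\<^bsub>M\<^esub> b \<odot>\<^bsub>M\<^esub> x"
    and smult_r_distr:
      "\<lbrakk>a \<in> carrier R; x \<in> carrier M; y \<in> carrier M\<rbrakk> \<Longrightarrow>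
        a \<odot>\<^bsub>M\<^esub> (x \<oplus>\<^bsub>M\<^esub> y) = a \<odot>\<^bsub>M\<^esub> x \<oplus>\<^bsub>M\<^esub> a \<odot>\<^bsub>M\<^esub> y"
    and smult_assoc1:
      "\<lbrakk>a \<in> carrier R; b \<in> carrier R; x \<in> carrier M\<rbrakk> \<Longrightarrow>
        (a \<otimes> b) \<odot>\<^bsub>M\<^esub> x = a \<odot>\<^bsub>M\<^esub> (b \<odot>\<^bsub>M\<^esub> x)"
    and smult_one [simp]:
      "x \<in> carrier M \<Longrightarrow> \<one> \<odot>\<^bsub>M\<^esub> x = x"
    and smult_l_null [simp]:
      "x \<in> carrier M \<Longrightarrow> \<zero> \<odot>\<^bsub>M\<^esub> x = \<zero>\<^bsub>M\<^esub>"
    and smult_r_null [simp]: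
      "a \<in> carrier R \<Longrightarrow> a \<odot>\<^bsub>M\<^esub> \<zero>\<^bsub>M\<^esub> = \<zero>\<^bsub>M\<^esub>"

locale subsemimodule = submonoid N "add_monoid M"
  for N and R :: "('a, 'c) ring_scheme" and M :: "('a, 'm, 'd) module_scheme" (structure) +
  assumes smult_closed:
    "\<lbrakk>a \<in> carrier R; x \<in> N\<rbrakk> \<Longrightarrow> a \<odot>\<^bsub>M\<^esub> x \<in> N"

(* The library's locale ideal requires R to be a ring. *)
locale semiring_ideal = submonoid I "add_monoid R" + csemiring R for I and R (structure) +
  assumes I_l_closed: "\<lbrakk>a \<in> I; x \<in> carrier R\<rbrakk> \<Longrightarrow> x \<otimes> a \<in> I"

definition mult_closed :: "('a, 'c) ring_scheme \<Rightarrow> 'a set \<Rightarrow> bool" where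
  "mult_closed R S \<longleftrightarrow> S \<subseteq> carrier R \<and> \<zero>\<^bsub>R\<^esub> \<notin> S \<and> \<one>\<^bsub>R\<^esub> \<in> S \<and>
    (\<forall>s\<in>S. \<forall>t\<in>S. s \<otimes>\<^bsub>R\<^esub> t \<in> S)"

definition nilradical :: "('a, 'c) ring_scheme \<Rightarrow> 'a set" where
  "nilradical R = {x \<in> carrier R. \<exists>n::nat. n > 0 \<and> x [^]\<^bsub>R\<^esub> n = \<zero>\<^bsub>R\<^esub>}"

definition quasi_S_n_ideal :: "('a, 'c) ring_scheme \<Rightarrow> 'a set \<Rightarrow> 'a set \<Rightarrow> bool" where
  "quasi_S_n_ideal R S I \<longleftrightarrow>
    semiring_ideal I R \<and> I \<noteq> carrier R \<and> I \<inter> S = {} \<and>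
    (\<exists>s\<in>S. \<forall>a\<in>carrier R. \<forall>b\<in>carrier R. a \<otimes>\<^bsub>R\<^esub> b \<in> I \<longrightarrow>
      s \<otimes>\<^bsub>R\<^esub> a [^]\<^bsub>R\<^esub> (2::nat) \<in> I \<or> s \<otimes>\<^bsub>R\<^esub> b \<in> nilradical R)"

(* The product IM: all finite sums of elements a m with a in I and m in M. *)
definition ideal_smult :: "'a set \<Rightarrow> ('a, 'm, 'd) module_scheme \<Rightarrow> 'm set" where
  "ideal_smult I M =
    {finsum M (\<lambda>i. a i \<odot>\<^bsub>M\<^esub> x i) {..<k} | (k::nat) a x.
      a \<in> {..<k} \<rightarrow> I \<and> x \<in> {..<k} \<rightarrow> carrier M}"

(* The semiring R(+)M. The subsets I(+)N and S(+)M of the literature are I \<times> N and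
   S \<times> carrier M. *)
definition idealization ::
    "('a, 'c) ring_scheme \<Rightarrow> ('a, 'm, 'd) module_scheme \<Rightarrow> ('a \<times> 'm) ring" where
  "idealization R M =
    \<lparr>carrier = carrier R \<times> carrier M,
     mult = (\<lambda>(r\<^sub>1, m\<^sub>1) (r\<^sub>2, m\<^sub>2).
       (r\<^sub>1 \<otimes>\<^bsub>R\<^esub> r\<^sub>2, r\<^sub>1 \<odot>\<^bsub>M\<^esub> m\<^sub>2 \<oplus>\<^bsub>M\<^esub> r\<^sub>2 \<odot>\<^bsub>M\<^esub> m\<^sub>1)),
     one = (\<one>\<^bsub>R\<^esub>, \<zero>\<^bsub>M\<^esub>),
     zero = (\<zero>\<^bsub>R\<^esub>, \<zero>\<^bsub>M\<^esub>),
     add = (\<lambda>(r\<^sub>1, m\<^sub>1) (r\<^sub>2, m\<^sub>2). (r\<^sub>1 \<oplus>\<^bsub>R\<^esub> r\<^sub>2, m\<^sub>1 \<oplus>\<^bsub>M\<^esub> m\<^sub>2))\<rparr>"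

context semimodule
begin

lemma csemiring_idealization: "csemiring (idealization R M)"
proof -
  show ?thesis
    by unfold_locales
      (auto simp: idealization_def R.l_distr R.r_distr smult_l_distr smult_r_distr
        smult_assoc1 [symmetric] R.a_ac R.m_ac M.a_ac R.one_not_zero)
qed

lemma mult_closed_idealization:
  assumes "mult_closed R S"
  shows "mult_closed (idealization R M) (S \<times> carrier M)"
  using assms by (auto simp: mult_closed_def idealization_def subset_eq)

lemma semiring_ideal_idealization:
  assumes N: "subsemimodule N R M" and I: "semiring_ideal I R" and IM: "ideal_smult I M \<subseteq> N"
  shows "semiring_ideal (I \<times> N) (idealization R M)"
proof -
  interpret N: subsemimodule N R M by (rule N)
  interpret I: semiring_ideal I R by (rule I)
  have I_carrier: "a \<in> carrier R" if "a \<in> I" for a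
    using I.subset that by auto
  have N_carrier: "x \<in> carrier M" if "x \<in> N" for x
    using N.subset that by auto
  have smult: "a \<odot>\<^bsub>M\<^esub> x \<in> N" if "a \<in> I" "x \<in> carrier M" for a x
  proof -
    have "finsum M (\<lambda>i. a \<odot>\<^bsub>M\<^esub> x) {..<1::nat} \<in> ideal_smult I M"
      unfolding ideal_smult_def using that by fastforce
    then show ?thesis
      using IM that I_carrier by (auto simp: lessThan_Suc)
  qed
  interpret J: csemiring "idealization R M" by (rule csemiring_idealization)
  show ?thesis
    apply unfold_locales
    using I.m_closed N.m_closed I.one_closed N.one_closed
    by (auto simp: idealization_def I_carrier N_carrier smult I.I_l_closed N.smult_closed)
qed

end

end

theory Submission
  imports Defs
begin

text \<open>
  Write elements of \<open>R(+)M\<close> as pairs. The summand \<open>M\<close> squares to zero, so nilpotency of a pair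
  depends on its first component only (\<open>nilradical_idealization\<close>). Each of the two
  alternatives in the definition of a quasi \<open>S\<close>-\<open>n\<close>-ideal can therefore be compared with its
  first component.

  Going down from \<open>R(+)M\<close> to \<open>R\<close>, it is enough to test pairs of the form \<open>(a, 0)\<close> and to project.

  Going up, a witness \<open>s\<close> for \<open>I\<close> gives the witness \<open>(s, 0)\<close> for \<open>I(+)N\<close>. The alternative
  ``\<open>s b\<close> is nilpotent'' lifts at once. In the alternative \<open>s a\<^sup>2 \<in> I\<close> there is a second
  component to control, since \<open>(s, 0) (a, m)\<^sup>2 = (s a\<^sup>2, s a m + s a m)\<close>. Here the quasi
  \<open>S\<close>-\<open>n\<close>-condition is used again: applied to the product of \<open>1\<close> and \<open>s a\<^sup>2\<close>, it shows that
  \<open>s a\<close> is itself nilpotent (\<open>quasi_S_n_nilpotent\<close>), and hence \<open>s a m\<close> lies in \<open>N(R) M \<subseteq> N\<close>.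
\<close>

context csemiring
begin

lemma nilradical_square_rootI:
  assumes "x \<in> carrier R" and "x [^] (2::nat) \<in> nilradical R"
  shows "x \<in> nilradical R"
proof -
  obtain n :: nat where "n > 0" and "(x [^] (2::nat)) [^] n = \<zero>"
    using assms(2) by (auto simp: nilradical_def)
  then have "2 * n > 0" and "x [^] (2 * n) = \<zero>"
    using assms(1) by (simp_all add: nat_pow_pow)
  then show ?thesis
    using assms(1) unfolding nilradical_def by blast
qed

text \<open>
  Since \<open>s \<notin> I\<close>, the case \<open>a = 1\<close> of the condition forces \<open>s I \<subseteq> N(R)\<close>. In particular
  \<open>(s a)\<^sup>2 = s (s a\<^sup>2)\<close> is nilpotent whenever \<open>s a\<^sup>2 \<in> I\<close>.
\<close>

lemma quasi_S_n_nilpotent: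
  assumes s: "s \<in> carrier R" "s \<notin> I" and a: "a \<in> carrier R"
    and quasi: "\<And>a b. \<lbrakk>a \<in> carrier R; b \<in> carrier R; a \<otimes> b \<in> I\<rbrakk> \<Longrightarrow>
      s \<otimes> a [^] (2::nat) \<in> I \<or> s \<otimes> b \<in> nilradical R"
    and sa2: "s \<otimes> a [^] (2::nat) \<in> I"
  shows "s \<otimes> a \<in> nilradical R"
proof -
  have "s \<otimes> (s \<otimes> a [^] (2::nat)) \<in> nilradical R"
    using quasi [of \<one> "s \<otimes> a [^] (2::nat)"] s a sa2 by simp
  moreover have "(s \<otimes> a) [^] (2::nat) = s \<otimes> (s \<otimes> a [^] (2::nat))"
    using s a by (simp add: numeral_2_eq_2 m_ac)
  ultimately show ?thesis
    using s a by (simp add: nilradical_square_rootI)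
qed

end

context semimodule
begin

lemma smult_mem_ideal_smult:
  assumes "A \<subseteq> carrier R" "a \<in> A" "x \<in> carrier M"
  shows "a \<odot>\<^bsub>M\<^esub> x \<in> ideal_smult A M"
proof -
  have "finsum M (\<lambda>i. a \<odot>\<^bsub>M\<^esub> x) {..<1::nat} \<in> ideal_smult A M"
    unfolding ideal_smult_def using assms by fastforce
  moreover have "finsum M (\<lambda>i. a \<odot>\<^bsub>M\<^esub> x) {..<1::nat} = a \<odot>\<^bsub>M\<^esub> x"
    using assms by (auto simp: lessThan_Suc)
  ultimately show ?thesis
    by simp
qed

lemma idealization_pow_closed:
  assumes "p \<in> carrier R \<times> carrier M"
  shows "p [^]\<^bsub>idealization R M\<^esub> (n::nat) \<in> carrier R \<times> carrier M"
proof -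
  interpret J: csemiring "idealization R M"
    by (rule csemiring_idealization)
  show ?thesis
    using J.nat_pow_closed [of p n] assms by (simp add: idealization_def)
qed

lemma fst_idealization_pow:
  "fst (p [^]\<^bsub>idealization R M\<^esub> (n::nat)) = fst p [^] n"
  by (induction n) (auto simp: nat_pow_def idealization_def split: prod.splits)

lemma idealization_square:
  assumes "a \<in> carrier R" "m \<in> carrier M"
  shows "(a, m) [^]\<^bsub>idealization R M\<^esub> (2::nat)
    = (a [^] (2::nat), a \<odot>\<^bsub>M\<^esub> m \<oplus>\<^bsub>M\<^esub> a \<odot>\<^bsub>M\<^esub> m)"
proof -
  interpret J: csemiring "idealization R M"
    by (rule csemiring_idealization)
  have "(a, m) \<in> carrier (idealization R M)"
    using assms by (simp add: idealization_def)
  then have "(a, m) [^]\<^bsub>idealization R M\<^esub> (2::nat)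
      = (a, m) \<otimes>\<^bsub>idealization R M\<^esub> (a, m)"
    by (simp add: numeral_2_eq_2)
  then show ?thesis
    using assms by (simp add: idealization_def numeral_2_eq_2)
qed

text \<open>
  If \<open>x\<^sup>n = 0\<close>, then \<open>(x, m)\<^sup>n\<close> has first component \<open>0\<close>, and the square of any such pair is zero,
  so the exponent \<open>2 n\<close> kills \<open>(x, m)\<close>.
\<close>

lemma nilradical_idealization:
  "nilradical (idealization R M) = nilradical R \<times> carrier M"
proof -
  interpret J: csemiring "idealization R M"
    by (rule csemiring_idealization)
  have carrier: "carrier (idealization R M) = carrier R \<times> carrier M"
    and zero: "\<zero>\<^bsub>idealization R M\<^esub> = (\<zero>, \<zero>\<^bsub>M\<^esub>)"
    by (simp_all add: idealization_def)
  have "(x, m) \<in> nilradical (idealization R M)"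
    if x: "x \<in> nilradical R" and m: "m \<in> carrier M" for x m
  proof -
    obtain n :: nat where n: "n > 0" "x [^] n = \<zero>" and xR: "x \<in> carrier R"
      using x by (auto simp: nilradical_def)
    obtain y where y: "(x, m) [^]\<^bsub>idealization R M\<^esub> n = (\<zero>, y)" "y \<in> carrier M"
      using fst_idealization_pow [of "(x, m)" n] idealization_pow_closed [of "(x, m)" n] n xR m
      by (cases "(x, m) [^]\<^bsub>idealization R M\<^esub> n") auto
    have "((x, m) [^]\<^bsub>idealization R M\<^esub> n) [^]\<^bsub>idealization R M\<^esub> (2::nat)
        = \<zero>\<^bsub>idealization R M\<^esub>"
      using y by (simp add: idealization_square zero) (simp add: numeral_2_eq_2)
    moreover have xm: "(x, m) \<in> carrier (idealization R M)"
      using xR m by (simp add: carrier)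
    ultimately have "(x, m) [^]\<^bsub>idealization R M\<^esub> (n * 2) = \<zero>\<^bsub>idealization R M\<^esub>"
      using J.nat_pow_pow [OF xm, of n 2] by simp
    moreover have "n * 2 > 0"
      using n by simp
    ultimately show ?thesis
      using xm
      unfolding nilradical_def by blast
  qed
  moreover have "fst p \<in> nilradical R \<and> snd p \<in> carrier M"
    if p: "p \<in> nilradical (idealization R M)" for p
  proof -
    obtain n :: nat where "n > 0" and "p [^]\<^bsub>idealization R M\<^esub> n = (\<zero>, \<zero>\<^bsub>M\<^esub>)"
      using p by (auto simp: nilradical_def zero)
    then have "fst p [^] n = \<zero>"
      using fst_idealization_pow [of p n] by simp
    then show ?thesis
      using \<open>n > 0\<close> p by (auto simp: nilradical_def carrier)
  qed
  ultimately show ?thesis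
    by (auto simp: mem_Times_iff)
qed

lemma quasi_S_n_ideal_of_idealization:
  assumes S: "mult_closed R S" and I: "semiring_ideal I R" and disj: "I \<inter> S = {}"
    and N: "\<zero>\<^bsub>M\<^esub> \<in> N"
    and quasi: "quasi_S_n_ideal (idealization R M) (S \<times> carrier M) (I \<times> N)"
  shows "quasi_S_n_ideal R S I"
proof -
  obtain su where "su \<in> S \<times> carrier M"
    and "\<forall>p\<in>carrier (idealization R M). \<forall>q\<in>carrier (idealization R M).
      p \<otimes>\<^bsub>idealization R M\<^esub> q \<in> I \<times> N \<longrightarrow>
      su \<otimes>\<^bsub>idealization R M\<^esub> p [^]\<^bsub>idealization R M\<^esub> (2::nat) \<in> I \<times> N \<or>
      su \<otimes>\<^bsub>idealization R M\<^esub> q \<in> nilradical R \<times> carrier M"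
    using quasi unfolding quasi_S_n_ideal_def nilradical_idealization by (elim conjE bexE)
  moreover obtain s u where "su = (s, u)"
    by (rule prod.exhaust)
  ultimately have su: "s \<in> S" "u \<in> carrier M"
    and q: "\<And>p q. \<lbrakk>p \<in> carrier (idealization R M); q \<in> carrier (idealization R M);
      p \<otimes>\<^bsub>idealization R M\<^esub> q \<in> I \<times> N\<rbrakk> \<Longrightarrow>
      (s, u) \<otimes>\<^bsub>idealization R M\<^esub> p [^]\<^bsub>idealization R M\<^esub> (2::nat) \<in> I \<times> N \<or>
      (s, u) \<otimes>\<^bsub>idealization R M\<^esub> q \<in> nilradical R \<times> carrier M"
    by simp_all
  have "s \<otimes> a [^] (2::nat) \<in> I \<or> s \<otimes> b \<in> nilradical R"
    if ab: "a \<in> carrier R" "b \<in> carrier R" "a \<otimes> b \<in> I" for a b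
  proof -
    have "(a, \<zero>\<^bsub>M\<^esub>) \<in> carrier (idealization R M)" "(b, \<zero>\<^bsub>M\<^esub>) \<in> carrier (idealization R M)"
      and "(a, \<zero>\<^bsub>M\<^esub>) \<otimes>\<^bsub>idealization R M\<^esub> (b, \<zero>\<^bsub>M\<^esub>) \<in> I \<times> N"
      using ab N by (simp_all add: idealization_def)
    from q [OF this] show ?thesis
      unfolding idealization_square [OF ab(1) M.zero_closed]
      by (simp add: idealization_def) blast
  qed
  moreover have "\<one> \<in> carrier R - I"
    using S disj by (auto simp: mult_closed_def)
  ultimately show ?thesis
    unfolding quasi_S_n_ideal_def using I disj su(1) by blast
qed

lemma quasi_S_n_ideal_idealization:
  assumes S: "mult_closed R S" and N: "subsemimodule N R M" and IM: "ideal_smult I M \<subseteq> N"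
    and nil: "ideal_smult (nilradical R) M \<subseteq> N" and quasi: "quasi_S_n_ideal R S I"
  shows "quasi_S_n_ideal (idealization R M) (S \<times> carrier M) (I \<times> N)"
proof -
  interpret N: subsemimodule N R M
    by (rule N)
  have I: "semiring_ideal I R" and disj: "I \<inter> S = {}"
    using quasi by (auto simp: quasi_S_n_ideal_def)
  obtain s where s: "s \<in> S"
    and q: "\<And>a b. \<lbrakk>a \<in> carrier R; b \<in> carrier R; a \<otimes> b \<in> I\<rbrakk> \<Longrightarrow>
      s \<otimes> a [^] (2::nat) \<in> I \<or> s \<otimes> b \<in> nilradical R"
    using quasi unfolding quasi_S_n_ideal_def by blast
  have sR: "s \<in> carrier R" "s \<notin> I"
    using S s disj by (auto simp: mult_closed_def)
  have lift: "(s, \<zero>\<^bsub>M\<^esub>) \<otimes>\<^bsub>idealization R M\<^esub> (a, m) [^]\<^bsub>idealization R M\<^esub> (2::nat) \<in> I \<times> N"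
    if a: "a \<in> carrier R" "m \<in> carrier M" and sa2: "s \<otimes> a [^] (2::nat) \<in> I" for a m
  proof -
    have "s \<otimes> a \<in> nilradical R"
      using sR a(1) q sa2 by (rule R.quasi_S_n_nilpotent)
    then have "(s \<otimes> a) \<odot>\<^bsub>M\<^esub> m \<in> N"
      using smult_mem_ideal_smult [of "nilradical R" "s \<otimes> a" m] nil a
      by (auto simp: nilradical_def)
    then have "s \<odot>\<^bsub>M\<^esub> (a \<odot>\<^bsub>M\<^esub> m) \<oplus>\<^bsub>M\<^esub> s \<odot>\<^bsub>M\<^esub> (a \<odot>\<^bsub>M\<^esub> m) \<in> N"
      using N.m_closed a sR by (simp add: smult_assoc1)
    then show ?thesis
      using a sR sa2 by (simp add: idealization_square) (simp add: idealization_def smult_r_distr)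
  qed
  have main: "(s, \<zero>\<^bsub>M\<^esub>) \<otimes>\<^bsub>idealization R M\<^esub> p [^]\<^bsub>idealization R M\<^esub> (2::nat) \<in> I \<times> N \<or>
      (s, \<zero>\<^bsub>M\<^esub>) \<otimes>\<^bsub>idealization R M\<^esub> p' \<in> nilradical (idealization R M)"
    if p: "p \<in> carrier (idealization R M)" "p' \<in> carrier (idealization R M)"
      and pp': "p \<otimes>\<^bsub>idealization R M\<^esub> p' \<in> I \<times> N" for p p'
  proof -
    obtain a m b n where ab: "p = (a, m)" "p' = (b, n)"
      "a \<in> carrier R" "m \<in> carrier M" "b \<in> carrier R" "n \<in> carrier M" "a \<otimes> b \<in> I"
      using p pp' by (cases p; cases p') (auto simp: idealization_def)
    from q [OF ab(3,5,7)] show ?thesis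
    proof
      assume "s \<otimes> a [^] (2::nat) \<in> I"
      then show ?thesis
        using lift ab by blast
    next
      assume "s \<otimes> b \<in> nilradical R"
      moreover have "(s, \<zero>\<^bsub>M\<^esub>) \<otimes>\<^bsub>idealization R M\<^esub> (b, n) \<in> {s \<otimes> b} \<times> carrier M"
        using ab sR by (simp add: idealization_def)
      ultimately show ?thesis
        by (auto simp: nilradical_idealization ab(2) mem_Times_iff)
    qed
  qed
  have "(\<one>, \<zero>\<^bsub>M\<^esub>) \<in> carrier (idealization R M) - I \<times> N"
    using S disj by (auto simp: mult_closed_def idealization_def)
  then have "I \<times> N \<noteq> carrier (idealization R M)"
    by blast
  moreover have "(I \<times> N) \<inter> (S \<times> carrier M) = {}"
    using disj by blast
  moreover have "(s, \<zero>\<^bsub>M\<^esub>) \<in> S \<times> carrier M"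
    using s by simp
  ultimately show ?thesis
    unfolding quasi_S_n_ideal_def using semiring_ideal_idealization [OF N I IM]
    by (intro conjI bexI [of _ "(s, \<zero>\<^bsub>M\<^esub>)"] ballI impI main)
qed

end

theorem proposition3p1:
  fixes R :: "('a, 'c) ring_scheme" and M :: "('a, 'm, 'd) module_scheme"
    and S I :: "'a set" and N :: "'m set"
  assumes "csemiring R"
    and "semimodule R M"
    and "subsemimodule N R M"
    and "mult_closed R S"
    and "semiring_ideal I R"
    and "I \<inter> S = {}"
    and "ideal_smult I M \<subseteq> N"
  shows "(quasi_S_n_ideal (idealization R M) (S \<times> carrier M) (I \<times> N) \<longrightarrow>
            quasi_S_n_ideal R S I) \<and>
         (ideal_smult (nilradical R) M \<subseteq> N \<longrightarrow>
            quasi_S_n_ideal R S I \<longrightarrow>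
            quasi_S_n_ideal (idealization R M) (S \<times> carrier M) (I \<times> N))"
proof -
  interpret semimodule R M
    by (rule assms(2))
  interpret N: subsemimodule N R M
    by (rule assms(3))
  have "\<zero>\<^bsub>M\<^esub> \<in> N"
    using N.one_closed by simp
  then show ?thesis
    using quasi_S_n_ideal_of_idealization [OF assms(4-6)]
      quasi_S_n_ideal_idealization [OF assms(4,3,7)] by blast
qed

end
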